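(* For any integers $m\geq1$ and $k\geq0$ there exist rational numbers $\widetilde b_0,\dots,\widetilde b_k$ such that for all $y>0$, \[ \widetilde C_{2(m+k)-1,2k+1}(y)=\sum_{j=0}^k \widetilde b_j\frac{d^{2j}}{dy^{2j}}\Big(\widetilde C_{2(m+k-j)-1,1}(y)\Big). \]
   Context: Put $\tilde n=\frac{2n-1}{2}$. For integers $p$ and $m\ge1$ and real $y>0$, $\widetilde C_{p,m}(y)=\sum_{n=1}^\infty\frac{(-1)^{n-1}\tilde n^p}{\cosh^m(\tilde n y)}$. *)

theory Defs
  imports "HOL-Analysis.Analysis"
begin

definition ntilde :: "nat \<Rightarrow> real" where
  "ntilde n = (2 * real n - 1) / 2"

(* The summation index is shifted: the term at n here is the one at n + 1 in the
   series over n \<ge> 1, whence the sign (-1) ^ n. *)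
definition Ctilde :: "int \<Rightarrow> nat \<Rightarrow> real \<Rightarrow> real" where
  "Ctilde p m y = (\<Sum>n. (-1) ^ n * ntilde (Suc n) powi p / cosh (ntilde (Suc n) * y) ^ m)"

end

theory Submission
  imports Defs "HOL-Real_Asymp.Real_Asymp"
begin

text \<open>
  Since \<open>(sech\<^sup>s)'' = s\<^sup>2 sech\<^sup>s - s (s + 1) sech\<^sup>s\<^sup>+\<^sup>2\<close>, the odd power \<open>sech\<^sup>2\<^sup>k\<^sup>+\<^sup>1\<close> is a
  rational linear combination of the derivatives of \<open>sech\<close> of order \<open>0, 2, \<dots>, 2k\<close>.
  Substituting this in the series gives the theorem, because differentiating
  \<open>g (\<nu> y)\<close> in \<open>y\<close>, where \<open>\<nu> = n - 1/2\<close>, produces a factor \<open>\<nu>\<close> each time,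
  which accounts for the shift of the exponent by \<open>2j\<close>. Termwise differentiation is legitimate
  because each derivative of \<open>sech\<close> is \<open>sech\<close> times a polynomial in \<open>tanh\<close> and hence decays
  exponentially.
\<close>

section \<open>Alternating series with exponentially decaying terms\<close>

definition alt_series :: "(real \<Rightarrow> real) \<Rightarrow> int \<Rightarrow> real \<Rightarrow> real" where
  "alt_series g p y = (\<Sum>n. (-1) ^ n * ntilde (Suc n) powi p * g (ntilde (Suc n) * y))"

text \<open>Positive arguments suffice because the series evaluates \<open>g\<close> only at
  \<open>ntilde (Suc n) * y\<close> with \<open>y > 0\<close>.\<close>

definition exp_decaying :: "(real \<Rightarrow> real) \<Rightarrow> bool" where
  "exp_decaying g \<longleftrightarrow> (\<exists>K. \<forall>x>0. \<bar>g x\<bar> \<le> K * exp (- x))"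

lemma ntilde_Suc_pos: "ntilde (Suc n) > 0"
  by (simp add: ntilde_def)

lemma summable_ntilde_powi_exp:
  assumes "c > 0"
  shows "summable (\<lambda>n. ntilde (Suc n) powi p * exp (- (ntilde (Suc n) * c)))"
proof -
  \<comment> \<open>The asymptotic comparison is made with a real exponent; it agrees with the
    integer power because the base is positive.\<close>
  have "summable (\<lambda>n. ntilde (Suc n) powr of_int p * exp (- (ntilde (Suc n) * c)))"
  proof (rule summable_comparison_test_bigo)
    show "summable (\<lambda>n. norm (1 / real n ^ 2))"
      using inverse_power_summable[of 2, where 'a = real] by (simp add: field_simps)
    show "(\<lambda>n. ntilde (Suc n) powr of_int p * exp (- (ntilde (Suc n) * c)))
            \<in> O(\<lambda>n. 1 / real n ^ 2)"
      unfolding ntilde_def using assms by real_asymp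
  qed
  then show ?thesis
    by (simp add: powr_real_of_int' less_imp_le[OF ntilde_Suc_pos]
        less_imp_neq[OF ntilde_Suc_pos, symmetric])
qed

text \<open>The bound does not depend on \<open>y\<close> as long as \<open>c \<le> y\<close>, so it
  serves as a Weierstrass majorant for the differentiated series; \<open>c = y\<close> gives plain
  summability.\<close>

lemma exp_decaying_bound:
  assumes "exp_decaying g"
  obtains K where "\<And>n p c y. 0 < c \<Longrightarrow> c \<le> y \<Longrightarrow>
    norm ((-1) ^ n * ntilde (Suc n) powi p * g (ntilde (Suc n) * y))
      \<le> K * (ntilde (Suc n) powi p * exp (- (ntilde (Suc n) * c)))"
proof -
  from assms obtain K where K: "\<And>x. x > 0 \<Longrightarrow> \<bar>g x\<bar> \<le> K * exp (- x)"
    unfolding exp_decaying_def by blast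
  \<comment> \<open>\<open>exp_decaying\<close> does not fix the sign of \<open>K\<close>; the bound
    at \<open>1\<close> forces it.\<close>
  have "0 \<le> K * exp (- 1)"
    using K[of 1] by linarith
  then have "K \<ge> 0"
    by (simp add: zero_le_mult_iff)
  show thesis
  proof
    fix n p and c y :: real
    assume "0 < c" "c \<le> y"
    note pos = ntilde_Suc_pos[of n]
    have "\<bar>g (ntilde (Suc n) * y)\<bar> \<le> K * exp (- (ntilde (Suc n) * y))"
      using K pos \<open>0 < c\<close> \<open>c \<le> y\<close> by simp
    also have "\<dots> \<le> K * exp (- (ntilde (Suc n) * c))"
      using pos \<open>c \<le> y\<close> \<open>K \<ge> 0\<close> by (intro mult_left_mono) auto
    finally have "ntilde (Suc n) powi p * \<bar>g (ntilde (Suc n) * y)\<bar>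
        \<le> ntilde (Suc n) powi p * (K * exp (- (ntilde (Suc n) * c)))"
      using pos by (intro mult_left_mono zero_le_power_int) simp_all
    moreover have "norm ((-1) ^ n * ntilde (Suc n) powi p * g (ntilde (Suc n) * y))
        = ntilde (Suc n) powi p * \<bar>g (ntilde (Suc n) * y)\<bar>"
      using zero_less_power_int[OF pos, of p] by (simp add: abs_mult)
    ultimately show "norm ((-1) ^ n * ntilde (Suc n) powi p * g (ntilde (Suc n) * y))
        \<le> K * (ntilde (Suc n) powi p * exp (- (ntilde (Suc n) * c)))"
      by (simp only: mult.left_commute)
  qed
qed

lemma summable_alt_series:
  assumes "exp_decaying g" "y > 0"
  shows "summable (\<lambda>n. (-1) ^ n * ntilde (Suc n) powi p * g (ntilde (Suc n) * y))"
proof -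
  obtain K where "\<And>n p c y. 0 < c \<Longrightarrow> c \<le> y \<Longrightarrow>
    norm ((-1) ^ n * ntilde (Suc n) powi p * g (ntilde (Suc n) * y))
      \<le> K * (ntilde (Suc n) powi p * exp (- (ntilde (Suc n) * c)))"
    using exp_decaying_bound[OF assms(1)] by blast
  from this[OF assms(2) order_refl] show ?thesis
    by (rule summable_comparison_test'[OF summable_mult[OF summable_ntilde_powi_exp[OF assms(2)]]])
qed

lemma alt_series_has_field_derivative:
  assumes deriv: "\<And>x. (g has_field_derivative g' x) (at x)"
    and dec: "exp_decaying g" "exp_decaying g'" and "y > 0"
  shows "(alt_series g p has_field_derivative alt_series g' (p + 1) y) (at y)"
proof -
  \<comment> \<open>This open ray contains \<open>y\<close> and stays away from \<open>0\<close>, so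
    the single majorant with \<open>c = y/2\<close> covers all of it.\<close>
  let ?S = "{y/2<..}"
  let ?f = "\<lambda>n x. (-1) ^ n * ntilde (Suc n) powi p * g (ntilde (Suc n) * x)"
  let ?f' = "\<lambda>n x. (-1) ^ n * ntilde (Suc n) powi (p + 1) * g' (ntilde (Suc n) * x)"
  obtain K where K: "\<And>n p c y. 0 < c \<Longrightarrow> c \<le> y \<Longrightarrow>
    norm ((-1) ^ n * ntilde (Suc n) powi p * g' (ntilde (Suc n) * y))
      \<le> K * (ntilde (Suc n) powi p * exp (- (ntilde (Suc n) * c)))"
    using exp_decaying_bound[OF dec(2)] by blast
  have "((\<lambda>x. \<Sum>n. ?f n x) has_field_derivative (\<Sum>n. ?f' n y)) (at y)"
  proof (rule has_field_derivative_series'(2)[where S = ?S and ?x0.0 = y])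
    show "convex ?S" by simp
    show "(?f n has_field_derivative ?f' n x) (at x within ?S)" for n x
      using ntilde_Suc_pos[of n]
      by (auto intro!: derivative_eq_intros DERIV_chain2[OF deriv] simp: power_int_add)
    show "uniformly_convergent_on ?S (\<lambda>n x. \<Sum>i<n. ?f' i x)"
      using \<open>y > 0\<close>
      by (intro Weierstrass_m_test'[OF K[of "y/2"]] summable_mult summable_ntilde_powi_exp) auto
    show "summable (\<lambda>n. ?f n y)"
      using summable_alt_series[OF dec(1) \<open>y > 0\<close>] .
  qed (use \<open>y > 0\<close> in \<open>auto simp: interior_open\<close>)
  then show ?thesis
    unfolding alt_series_def .
qed

lemma alt_series_sum:
  assumes "finite A" "\<And>i. i \<in> A \<Longrightarrow> exp_decaying (g i)" "y > 0"
  shows "alt_series (\<lambda>x. \<Sum>i\<in>A. c i * g i x) p y = (\<Sum>i\<in>A. c i * alt_series (g i) p y)"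
proof -
  let ?t = "\<lambda>i n. (-1) ^ n * ntilde (Suc n) powi p * g i (ntilde (Suc n) * y)"
  have sm: "summable (?t i)" if "i \<in> A" for i
    using assms that by (intro summable_alt_series) auto
  have "alt_series (\<lambda>x. \<Sum>i\<in>A. c i * g i x) p y = (\<Sum>n. \<Sum>i\<in>A. c i * ?t i n)"
    unfolding alt_series_def by (simp add: sum_distrib_left mult_ac)
  also have "\<dots> = (\<Sum>i\<in>A. \<Sum>n. c i * ?t i n)"
    using sm by (intro suminf_sum summable_mult) auto
  also have "\<dots> = (\<Sum>i\<in>A. c i * alt_series (g i) p y)"
    unfolding alt_series_def using sm by (intro sum.cong suminf_mult) auto
  finally show ?thesis .
qed

section \<open>Derivatives of sech and of its alternating series\<close>

text \<open>The recursion comes from \<open>(sech \<cdot> P(tanh))' = sech \<cdot> Q(tanh)\<close> with \<open>Q = (1 - X\<^sup>2) P' - X P\<close>.\<close>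

primrec sech_poly :: "nat \<Rightarrow> real poly" where
  "sech_poly 0 = 1"
| "sech_poly (Suc n) = [:1, 0, -1:] * pderiv (sech_poly n) - [:0, 1:] * sech_poly n"

definition sech_deriv :: "nat \<Rightarrow> real \<Rightarrow> real" where
  "sech_deriv n x = poly (sech_poly n) (tanh x) / cosh x"

lemma sech_deriv_has_field_derivative:
  "(sech_deriv n has_field_derivative sech_deriv (Suc n) x) (at x)"
  unfolding sech_deriv_def [abs_def]
  by (rule derivative_eq_intros DERIV_chain2[OF poly_DERIV] | simp)+
    (simp add: field_simps power2_eq_square tanh_def)

lemma exp_decaying_sech_deriv: "exp_decaying (sech_deriv n)"
proof -
  \<comment> \<open>The values of \<open>tanh\<close> lie in a compact interval, so the polynomial
    factor is bounded and the decay comes from \<open>1 / cosh x\<close> alone.\<close>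
  have "bounded (poly (sech_poly n) ` {-1..1})"
    by (intro compact_imp_bounded compact_continuous_image continuous_intros) auto
  then obtain K where K: "\<And>t. t \<in> {-1..1} \<Longrightarrow> \<bar>poly (sech_poly n) t\<bar> \<le> K"
    unfolding bounded_iff by (metis image_eqI real_norm_def)
  have "\<bar>sech_deriv n x\<bar> \<le> (2 * K) * exp (- x)" for x
  proof -
    have "\<bar>poly (sech_poly n) (tanh x)\<bar> \<le> K"
      using K[of "tanh x"] tanh_real_bounds[of x] by auto
    moreover have "inverse (cosh x) \<le> 2 * exp (- x)"
      by (simp add: cosh_def exp_minus pos_divide_le_eq add_pos_pos) (simp add: field_simps)
    ultimately have "\<bar>poly (sech_poly n) (tanh x)\<bar> * inverse (cosh x) \<le> K * (2 * exp (- x))"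
      by (intro mult_mono) auto
    then show ?thesis
      by (simp add: sech_deriv_def divide_inverse abs_mult)
  qed
  then show ?thesis
    unfolding exp_decaying_def by blast
qed

lemma sech_deriv_0: "sech_deriv 0 x = 1 / cosh x"
  by (simp add: sech_deriv_def)

lemma deriv_funpow_alt_series_sech:
  assumes "y > 0"
  shows "(deriv ^^ n) (alt_series (sech_deriv 0) p) y = alt_series (sech_deriv n) (p + int n) y"
  using assms
proof (induction n arbitrary: y)
  case 0
  then show ?case by simp
next
  case (Suc n)
  have "(alt_series (sech_deriv n) (p + int n) has_field_derivative
      alt_series (sech_deriv (Suc n)) (p + int n + 1) y) (at y)"
    by (intro alt_series_has_field_derivative sech_deriv_has_field_derivative
        exp_decaying_sech_deriv Suc.prems)
  \<comment> \<open>The induction hypothesis holds only for positive arguments, so the two functions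
    are compared on a neighbourhood of \<open>y\<close> before differentiating.\<close>
  moreover have "eventually (\<lambda>z. z \<in> {0<..}) (nhds y)"
    using Suc.prems by (intro eventually_nhds_in_open) auto
  then have "eventually (\<lambda>z. (deriv ^^ n) (alt_series (sech_deriv 0) p) z
      = alt_series (sech_deriv n) (p + int n) z) (nhds y)"
    by eventually_elim (use Suc.IH in auto)
  then have "deriv ((deriv ^^ n) (alt_series (sech_deriv 0) p)) y
      = deriv (alt_series (sech_deriv n) (p + int n)) y"
    by (intro deriv_cong_ev refl)
  ultimately show ?case
    by (simp add: DERIV_imp_deriv algebra_simps)
qed

section \<open>Odd powers of sech as combinations of its even derivatives\<close>

text \<open>The first derivative is given explicitly as \<open>f' s\<close>, so that uniqueness of
  derivatives can later be applied once at each order.\<close>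

lemma sech_power_second_derivative:
  fixes x :: real
  defines "f' \<equiv> \<lambda>s x::real. - (real s * sinh x / cosh x ^ (s + 1))"
  shows "((\<lambda>x. 1 / cosh x ^ s) has_field_derivative f' s x) (at x)"
    and "(f' s has_field_derivative
      (real s)\<^sup>2 / cosh x ^ s - real s * (real s + 1) / cosh x ^ (s + 2)) (at x)"
proof -
  have "cosh x \<noteq> 0" by simp
  then show "((\<lambda>x. 1 / cosh x ^ s) has_field_derivative f' s x) (at x)"
    unfolding f'_def
    \<comment> \<open>The power rule yields the exponent \<open>s - 1\<close>, which truncates at
      \<open>s = 0\<close>; hence the case split.\<close>
    by (cases s) (auto intro!: derivative_eq_intros simp: divide_simps simp flip: power_Suc, simp)
  have "(f' s has_field_derivative
      - ((real s * cosh x * cosh x ^ (s + 1) - real s * sinh x * (real (s + 1) * cosh x ^ s * sinh x))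
        / (cosh x ^ (s + 1) * cosh x ^ (s + 1)))) (at x)"
  proof -
    have "((\<lambda>x::real. cosh x ^ (s + 1)) has_field_derivative real (s + 1) * cosh x ^ s * sinh x) (at x)"
      using DERIV_power[OF has_field_derivative_cosh[OF DERIV_ident], where n = "s + 1"]
      by (simp add: mult_ac)
    moreover have "(sinh has_field_derivative cosh x) (at x)"
      using has_field_derivative_sinh[OF DERIV_ident] by simp
    ultimately show ?thesis
      unfolding f'_def using \<open>cosh x \<noteq> 0\<close>
      by (intro DERIV_minus DERIV_divide DERIV_cmult) auto
  qed
  also have "real s * cosh x * cosh x ^ (s + 1) - real s * sinh x * (real (s + 1) * cosh x ^ s * sinh x)
      = real s * cosh x ^ s * ((cosh x)\<^sup>2 - real (s + 1) * (sinh x)\<^sup>2)"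
    by (simp add: algebra_simps power2_eq_square)
  \<comment> \<open>With \<open>sinh\<^sup>2 = cosh\<^sup>2 - 1\<close> the bracket becomes
    \<open>(s + 1) - s * cosh\<^sup>2\<close>, whose two terms give the two fractions.\<close>
  also have "- (real s * cosh x ^ s * ((cosh x)\<^sup>2 - real (s + 1) * (sinh x)\<^sup>2)
        / (cosh x ^ (s + 1) * cosh x ^ (s + 1)))
      = (real s)\<^sup>2 / cosh x ^ s - real s * (real s + 1) / cosh x ^ (s + 2)"
    unfolding sinh_square_eq using \<open>cosh x \<noteq> 0\<close>
    by (simp add: divide_simps) (simp add: algebra_simps power2_eq_square)
  finally show "(f' s has_field_derivative
      (real s)\<^sup>2 / cosh x ^ s - real s * (real s + 1) / cosh x ^ (s + 2)) (at x)" .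
qed

text \<open>In the induction step the expansion of the power \<open>s = 2 * k + 1\<close> is
  differentiated twice, and the second-derivative formula is solved for the power
  \<open>s + 2\<close>. Dividing by \<open>s * (s + 1)\<close> keeps the coefficients
  rational.\<close>

lemma odd_sech_power_eq_sum_derivs:
  "\<exists>b :: nat \<Rightarrow> rat. \<forall>x. 1 / cosh x ^ (2 * k + 1) = (\<Sum>j=0..k. of_rat (b j) * sech_deriv (2 * j) x)"
proof (induction k)
  case 0
  show ?case by (rule exI[of _ "\<lambda>_. 1"]) (simp add: sech_deriv_0)
next
  case (Suc k)
  then obtain b :: "nat \<Rightarrow> rat" where
    b: "\<And>x. 1 / cosh x ^ (2 * k + 1) = (\<Sum>j=0..k. of_rat (b j) * sech_deriv (2 * j) x)"
    by blast
  define s where "s = 2 * k + 1"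
  define f' where "f' = (\<lambda>x::real. - (real s * sinh x / cosh x ^ (s + 1)))"
  have "((\<lambda>x. 1 / cosh x ^ s) has_field_derivative
      (\<Sum>j=0..k. of_rat (b j) * sech_deriv (Suc (2 * j)) x)) (at x)" for x
    unfolding s_def b
    by (intro DERIV_sum DERIV_cmult sech_deriv_has_field_derivative)
  then have f': "f' = (\<lambda>x. \<Sum>j=0..k. of_rat (b j) * sech_deriv (Suc (2 * j)) x)"
    unfolding f'_def using DERIV_unique sech_power_second_derivative(1) by blast
  have "(f' has_field_derivative
      (\<Sum>j=0..k. of_rat (b j) * sech_deriv (Suc (Suc (2 * j))) x)) (at x)" for x
    unfolding f' by (intro DERIV_sum DERIV_cmult sech_deriv_has_field_derivative)
  then have f'': "(real s)\<^sup>2 / cosh x ^ s - real s * (real s + 1) / cosh x ^ (s + 2)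
      = (\<Sum>j=0..k. of_rat (b j) * sech_deriv (Suc (Suc (2 * j))) x)" for x
    unfolding f'_def using DERIV_unique sech_power_second_derivative(2) by blast
  define r where "r = (of_nat s * (of_nat s + 1) :: rat)"
  \<comment> \<open>The first part is \<open>s\<^sup>2\<close> times the old expansion, padded by
    zero at \<open>j = k + 1\<close>. The second is its second derivative, which moves the
    coefficient of order \<open>2 * (j - 1)\<close> to order \<open>2 * j\<close>.\<close>
  define c where "c j = ((if j \<le> k then (of_nat s)\<^sup>2 * b j else 0)
      - (if j = 0 then 0 else b (j - 1))) / r" for j
  have r: "(of_rat r :: real) = real s * (real s + 1)" "(of_rat r :: real) \<noteq> 0"
    unfolding r_def s_def by (simp_all add: of_rat_mult of_rat_add)
  then have "r \<noteq> 0" by auto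
  then have rc: "r * c j = (if j \<le> k then (of_nat s)\<^sup>2 * b j else 0)
      - (if j = 0 then 0 else b (j - 1))" for j
    by (simp add: c_def)
  show ?case
  proof (intro exI[of _ c] allI)
    fix x :: real
    \<comment> \<open>Multiplying by \<open>r\<close> clears the denominators of \<open>c\<close>;
      the factor is cancelled at the end.\<close>
    have "of_rat r * (\<Sum>j=0..Suc k. of_rat (c j) * sech_deriv (2 * j) x)
        = (\<Sum>j=0..Suc k. of_rat (r * c j) * sech_deriv (2 * j) x)"
      by (simp only: sum_distrib_left of_rat_mult mult.assoc)
    also have "\<dots> = (\<Sum>j=0..Suc k. (real s)\<^sup>2 * of_rat (if j \<le> k then b j else 0)
            * sech_deriv (2 * j) x)
        - (\<Sum>j=0..Suc k. of_rat (if j = 0 then 0 else b (j - 1)) * sech_deriv (2 * j) x)"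
      unfolding sum_subtractf[symmetric] rc
      by (intro sum.cong) (auto simp: of_rat_mult of_rat_diff of_rat_power of_rat_minus algebra_simps)
    also have "(\<Sum>j=0..Suc k. (real s)\<^sup>2 * of_rat (if j \<le> k then b j else 0)
        * sech_deriv (2 * j) x) = (real s)\<^sup>2 * (1 / cosh x ^ s)"
      unfolding s_def b by (simp add: sum_distrib_left mult.assoc)
    also have "(\<Sum>j=0..Suc k. of_rat (if j = 0 then 0 else b (j - 1)) * sech_deriv (2 * j) x)
        = (\<Sum>j=0..k. of_rat (b j) * sech_deriv (Suc (Suc (2 * j))) x)"
      by (subst sum.atLeast0_atMost_Suc_shift) simp
    also have "\<dots> = (real s)\<^sup>2 / cosh x ^ s - of_rat r * (1 / cosh x ^ (s + 2))"
      using f''[of x] r(1) by simp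
    finally have "of_rat r * (\<Sum>j=0..Suc k. of_rat (c j) * sech_deriv (2 * j) x)
        = of_rat r * (1 / cosh x ^ (s + 2))"
      by simp
    then have "(\<Sum>j=0..Suc k. of_rat (c j) * sech_deriv (2 * j) x) = 1 / cosh x ^ (s + 2)"
      by (rule iffD1[OF mult_left_cancel[OF r(2)]])
    then show "1 / cosh x ^ (2 * Suc k + 1) = (\<Sum>j=0..Suc k. of_rat (c j) * sech_deriv (2 * j) x)"
      by (simp add: s_def)
  qed
qed

lemma Ctilde_eq_alt_series: "Ctilde p m = alt_series (\<lambda>x. 1 / cosh x ^ m) p"
  by (simp add: fun_eq_iff Ctilde_def alt_series_def)

theorem theorem4p10:
  fixes m k :: nat
  assumes "m \<ge> 1"
  shows "\<exists>b :: nat \<Rightarrow> rat. \<forall>y::real. y > 0 \<longrightarrow>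
    Ctilde (2 * (int m + int k) - 1) (2 * k + 1) y =
      (\<Sum>j = 0..k. of_rat (b j) *
        (deriv ^^ (2 * j)) (Ctilde (2 * (int m + int k - int j) - 1) 1) y)"
proof -
  let ?p = "2 * (int m + int k) - 1"
  obtain b :: "nat \<Rightarrow> rat" where
    b: "\<And>x. 1 / cosh x ^ (2 * k + 1) = (\<Sum>j=0..k. of_rat (b j) * sech_deriv (2 * j) x)"
    using odd_sech_power_eq_sum_derivs by blast
  have "Ctilde ?p (2 * k + 1) y = (\<Sum>j=0..k. of_rat (b j) *
      (deriv ^^ (2 * j)) (Ctilde (2 * (int m + int k - int j) - 1) 1) y)" if "y > 0" for y
  proof -
    have "Ctilde ?p (2 * k + 1) y = (\<Sum>j=0..k. of_rat (b j) * alt_series (sech_deriv (2 * j)) ?p y)"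
      unfolding Ctilde_eq_alt_series b
      by (intro alt_series_sum exp_decaying_sech_deriv that) auto
    \<comment> \<open>This holds for every \<open>j\<close>, also beyond \<open>k\<close>: the
      exponents are integers, so the subtraction does not truncate, and \<open>2 * j\<close>
      derivatives raise the lowered exponent back to \<open>?p\<close>.\<close>
    also have "(\<lambda>j. alt_series (sech_deriv (2 * j)) ?p y)
        = (\<lambda>j. (deriv ^^ (2 * j)) (Ctilde (2 * (int m + int k - int j) - 1) 1) y)"
    proof
      fix j
      show "alt_series (sech_deriv (2 * j)) ?p y
          = (deriv ^^ (2 * j)) (Ctilde (2 * (int m + int k - int j) - 1) 1) y"
      using deriv_funpow_alt_series_sech[OF that, of "2 * j" "2 * (int m + int k - int j) - 1"]
      by (simp add: Ctilde_eq_alt_series sech_deriv_0[abs_def] algebra_simps)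
    qed
    finally show ?thesis .
  qed
  then show ?thesis by blast
qed

end
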